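(* For all integers $n\ge 0$, $A$, $B$, $$f_{(i)}(n+1,A,B)=f_{(i)}(n,A,B)+f_{(i)}(n,A-1,B)+\sum_{j=0}^{A}f_{(i)}(n,A+1,B-j)+\sum_{j=0}^{A-1}f_{(i)}(n,A,B-j).$$
   Context: A marked set partition of $[n]=\{1,\dots,n\}$ is a set partition of $[n]$ with each block marked open or closed; $o(\lambda)$ is its number of open blocks. An arc of $\lambda$ is a pair $(a,b)$, $a<b$, of elements of the same block with no element of that block strictly between them. The intertwining weight of $\lambda$ is the number of pairs of arcs $(a,b),(c,e)$ with $a<c<b<e$, plus the number of pairs (arc $(a,b)$, open block $\mathbf B$) such that $a<\max\mathbf{B}<b$. Let $f_{(i)}(n,A,B)$ be the number of marked set partitions of $[n]$ with $A$ open blocks and intertwining weight $B$ (zero if $A<0$). For $A=0$ the weight is the number of 2-crossings $i(\lambda)$. *)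

theory Defs
  imports Main "HOL-Library.Disjoint_Sets"
begin

text \<open>A marked set partition is a pair \<open>(P, O)\<close>: the set \<open>P\<close> of all blocks together with the
  set \<open>O \<subseteq> P\<close> of the open ones; the blocks in \<open>P - O\<close> are the closed ones.\<close>

type_synonym marked_partition = "nat set set \<times> nat set set"

definition marked_partitions :: "nat \<Rightarrow> marked_partition set" where
  "marked_partitions n = {(P, Op). partition_on {1..n} P \<and> Op \<subseteq> P}"

definition blocks :: "marked_partition \<Rightarrow> nat set set" where
  "blocks L = fst L"

definition open_blocks :: "marked_partition \<Rightarrow> nat set set" where
  "open_blocks L = snd L"

definition num_open :: "marked_partition \<Rightarrow> nat" where
  "num_open L = card (open_blocks L)"

definition arcs :: "marked_partition \<Rightarrow> (nat \<times> nat) set" where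
  "arcs L = {(a, b). a < b \<and>
     (\<exists>X \<in> blocks L. a \<in> X \<and> b \<in> X \<and> \<not> (\<exists>c \<in> X. a < c \<and> c < b))}"

definition arc_crossings :: "marked_partition \<Rightarrow> ((nat \<times> nat) \<times> (nat \<times> nat)) set" where
  "arc_crossings L = {((a, b), (c, e)).
     (a, b) \<in> arcs L \<and> (c, e) \<in> arcs L \<and> a < c \<and> c < b \<and> b < e}"

definition open_crossings :: "marked_partition \<Rightarrow> ((nat \<times> nat) \<times> nat set) set" where
  "open_crossings L = {((a, b), X).
     (a, b) \<in> arcs L \<and> X \<in> open_blocks L \<and> a < Max X \<and> Max X < b}"

definition intertwining_weight :: "marked_partition \<Rightarrow> nat" where
  "intertwining_weight L = card (arc_crossings L) + card (open_crossings L)"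

text \<open>The parameters \<open>A\<close> and \<open>B\<close> are integers, so that the count is 0 if either is negative.\<close>

definition f_i :: "nat \<Rightarrow> int \<Rightarrow> int \<Rightarrow> nat" where
  "f_i n A B = card {L \<in> marked_partitions n.
     int (num_open L) = A \<and> int (intertwining_weight L) = B}"

end

theory Submission
  imports Defs
begin

text \<open>Delete the element \<open>n + 1\<close> from a marked partition of \<open>[n + 1]\<close>. If it was a singleton block,
  closed or open, the weight does not change; this gives the first two terms. Otherwise, mark the
  block \<open>X\<close> that remains as open. Every arc that passed over \<open>Max X\<close> used to cross the deleted arc
  \<open>(Max X, n + 1)\<close> and now crosses the open block \<open>X\<close> instead, so the weight drops exactly by the
  number of open blocks whose maximum exceeds \<open>Max X\<close>. As \<open>X\<close> runs through the \<open>k\<close> open blocks, this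
  number takes each value \<open>0, \<dots>, k - 1\<close> once; this gives the two sums, according to whether the block
  of \<open>n + 1\<close> was closed (then \<open>k = A + 1\<close>) or open (then \<open>k = A\<close>).\<close>

section \<open>Two ways of inserting a new largest element\<close>

definition add_singleton :: "nat \<Rightarrow> bool \<Rightarrow> marked_partition \<Rightarrow> marked_partition" where
  "add_singleton m op L =
    (insert {m} (blocks L), if op then insert {m} (open_blocks L) else open_blocks L)"

text \<open>The block to be extended is paired with its partition, so that injectivity and images
  concern one function on a set of pairs. The flag \<open>op\<close> is the mark of the enlarged
  block.\<close>

definition extend_block ::
    "nat \<Rightarrow> bool \<Rightarrow> marked_partition \<times> nat set \<Rightarrow> marked_partition" where
  "extend_block m op = (\<lambda>(L, X). (insert (insert m X) (blocks L - {X}),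
     if op then insert (insert m X) (open_blocks L - {X}) else open_blocks L - {X}))"

text \<open>Only one block of a partition contains a given element, so for such an element the union
  is that block. It serves to read off which insertion produced a partition, and with which
  mark.\<close>

definition block_of :: "nat \<Rightarrow> marked_partition \<Rightarrow> nat set" where
  "block_of m L = \<Union>{Y \<in> blocks L. m \<in> Y}"

text \<open>These are the open blocks that the arc \<open>(Max X, n + 1)\<close> will cross; the
  upper bound \<open>Max Y < n + 1\<close> is automatic.\<close>

definition open_above :: "marked_partition \<Rightarrow> nat set \<Rightarrow> nat set set" where
  "open_above L X = {Y \<in> open_blocks L. Max X < Max Y}"

text \<open>The domain on which \<open>extend_block\<close> is counted: \<open>A\<close> is the
  number of open blocks before the extension, \<open>B\<close> the weight after it.\<close>

definition open_pointed :: "nat \<Rightarrow> int \<Rightarrow> int \<Rightarrow> (marked_partition \<times> nat set) set" where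
  "open_pointed n A B = {(L, X). L \<in> marked_partitions n \<and> X \<in> open_blocks L \<and>
     int (num_open L) = A \<and> int (intertwining_weight L + card (open_above L X)) = B}"

section \<open>Elementary facts and finiteness\<close>

lemma marked_partitionsD:
  assumes "L \<in> marked_partitions n"
  shows "partition_on {1..n} (blocks L)" "open_blocks L \<subseteq> blocks L"
    "finite (blocks L)" "finite (open_blocks L)"
    "\<And>Y. Y \<in> blocks L \<Longrightarrow> finite Y \<and> Y \<noteq> {} \<and> Y \<subseteq> {1..n} \<and> Max Y \<in> Y \<and> Max Y \<le> n"
    "\<And>Y Z x. \<lbrakk>Y \<in> blocks L; Z \<in> blocks L; x \<in> Y; x \<in> Z\<rbrakk> \<Longrightarrow> Y = Z"
proof -
  show P: "partition_on {1..n} (blocks L)" and O: "open_blocks L \<subseteq> blocks L"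
    using assms by (auto simp: marked_partitions_def blocks_def open_blocks_def)
  show fin: "finite (blocks L)" using P by (rule finite_elements[rotated]) simp
  show "finite (open_blocks L)" using fin O by (rule finite_subset[rotated])
  show "finite Y \<and> Y \<noteq> {} \<and> Y \<subseteq> {1..n} \<and> Max Y \<in> Y \<and> Max Y \<le> n"
    if Y: "Y \<in> blocks L" for Y
  proof -
    have sub: "Y \<subseteq> {1..n}" and ne: "Y \<noteq> {}" using Y P by (auto simp: partition_on_def)
    have "finite Y" using sub finite_subset by blast
    with ne have "Max Y \<in> Y" by simp
    with sub ne \<open>finite Y\<close> show ?thesis by auto
  qed
  show "Y = Z" if "Y \<in> blocks L" "Z \<in> blocks L" "x \<in> Y" "x \<in> Z" for Y Z x
    using P that by (auto simp: partition_on_def disjoint_def)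
qed

lemma Suc_notin_blocks:
  assumes "L \<in> marked_partitions n"
  shows "Y \<in> blocks L \<Longrightarrow> Suc n \<notin> Y" "insert (Suc n) X \<notin> blocks L"
    "insert (Suc n) X \<notin> open_blocks L"
proof -
  show notin: "Suc n \<notin> Y" if "Y \<in> blocks L" for Y
    using marked_partitionsD(5)[OF assms that] by auto
  show "insert (Suc n) X \<notin> blocks L" using notin by blast
  then show "insert (Suc n) X \<notin> open_blocks L" using marked_partitionsD(2)[OF assms] by blast
qed

lemma finite_marked_partitions: "finite (marked_partitions n)"
proof -
  have "marked_partitions n \<subseteq> Pow (Pow {1..n}) \<times> Pow (Pow {1..n})"
    by (auto simp: marked_partitions_def partition_on_def)
  then show ?thesis by (rule finite_subset) auto
qed

lemma arcs_bounds:
  assumes "L \<in> marked_partitions n" "(a, b) \<in> arcs L"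
  shows "a < b" "a \<le> n" "b \<le> n"
proof -
  obtain Y where "Y \<in> blocks L" "a \<in> Y" "b \<in> Y" and less: "a < b"
    using assms(2) by (auto simp: arcs_def)
  then have "a \<in> {1..n}" "b \<in> {1..n}" using marked_partitionsD(5)[OF assms(1)] by blast+
  with less show "a < b" "a \<le> n" "b \<le> n" by auto
qed

lemma finite_arcs:
  assumes "L \<in> marked_partitions n"
  shows "finite (arcs L)"
proof -
  have "arcs L \<subseteq> {..n} \<times> {..n}" using arcs_bounds[OF assms] by auto
  then show ?thesis by (rule finite_subset) simp
qed

lemma finite_arc_crossings:
  assumes "L \<in> marked_partitions n"
  shows "finite (arc_crossings L)"
proof -
  have "arc_crossings L \<subseteq> arcs L \<times> arcs L" by (auto simp: arc_crossings_def)
  then show ?thesis by (rule finite_subset) (simp add: finite_arcs[OF assms])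
qed

lemma finite_open_crossings:
  assumes "L \<in> marked_partitions n"
  shows "finite (open_crossings L)"
proof -
  have "open_crossings L \<subseteq> arcs L \<times> open_blocks L" by (auto simp: open_crossings_def)
  then show ?thesis
    by (rule finite_subset) (simp add: finite_arcs[OF assms] marked_partitionsD(4)[OF assms])
qed

subsection \<open>Adding a singleton\<close>

lemma add_singleton_in:
  assumes "L \<in> marked_partitions n"
  shows "add_singleton (Suc n) op L \<in> marked_partitions (Suc n)"
proof -
  note D = marked_partitionsD[OF assms]
  have "partition_on (insert (Suc n) {1..n}) (insert {Suc n} (blocks L))"
    using partition_on_insert[of "{Suc n}" "blocks L" "insert (Suc n) {1..n}"] D(1)
      Suc_notin_blocks(1)[OF assms]
    by (auto simp: disjnt_def)
  moreover have "insert (Suc n) {1..n} = {1..Suc n}" by auto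
  ultimately show ?thesis
    using D(2) by (auto simp: marked_partitions_def add_singleton_def)
qed

lemma arcs_add_singleton:
  "arcs (add_singleton m op L) = arcs L"
  by (auto simp: arcs_def add_singleton_def blocks_def)

lemma num_open_add_singleton:
  assumes "L \<in> marked_partitions n"
  shows "num_open (add_singleton (Suc n) op L) = num_open L + (if op then 1 else 0)"
proof -
  note D = marked_partitionsD[OF assms]
  have "{Suc n} \<notin> open_blocks L" using Suc_notin_blocks(3)[OF assms, of "{}"] by simp
  then show ?thesis using D(4) by (simp add: num_open_def add_singleton_def open_blocks_def)
qed

text \<open>A singleton carries no arc, and if it is open its maximum \<open>Suc n\<close> lies
  under no arc, since all arcs end at \<open>n\<close> or earlier.\<close>

lemma intertwining_weight_add_singleton:
  assumes "L \<in> marked_partitions n"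
  shows "intertwining_weight (add_singleton (Suc n) op L) = intertwining_weight L"
proof -
  have "open_crossings (add_singleton (Suc n) op L) = open_crossings L"
    unfolding open_crossings_def arcs_add_singleton
    by (auto simp: add_singleton_def open_blocks_def dest: arcs_bounds(3)[OF assms]
        split: if_splits)
  then show ?thesis
    by (simp add: intertwining_weight_def arc_crossings_def arcs_add_singleton)
qed

lemma block_of_add_singleton:
  assumes "L \<in> marked_partitions n"
  shows "block_of (Suc n) (add_singleton (Suc n) op L) = {Suc n}"
  using Suc_notin_blocks(1)[OF assms]
  by (auto simp: block_of_def add_singleton_def blocks_def)

lemma block_of_add_singleton_open:
  assumes "L \<in> marked_partitions n"
  shows "block_of (Suc n) (add_singleton (Suc n) op L) \<in>
    open_blocks (add_singleton (Suc n) op L) \<longleftrightarrow> op"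
  unfolding block_of_add_singleton[OF assms]
  using Suc_notin_blocks(3)[OF assms, of "{}"]
  by (simp add: add_singleton_def open_blocks_def)

text \<open>Removing \<open>{Suc n}\<close> from both components undoes the insertion, because it
  was in neither of them before.\<close>

lemma inj_on_add_singleton: "inj_on (add_singleton (Suc n) op) (marked_partitions n)"
proof (rule inj_on_inverseI[where
      g = "\<lambda>L. (blocks L - {{Suc n}}, open_blocks L - {{Suc n}})"])
  fix L assume L: "L \<in> marked_partitions n"
  have "{Suc n} \<notin> blocks L" "{Suc n} \<notin> open_blocks L"
    using Suc_notin_blocks(2,3)[OF L, of "{}"] by simp_all
  then show "(blocks (add_singleton (Suc n) op L) - {{Suc n}},
      open_blocks (add_singleton (Suc n) op L) - {{Suc n}}) = L"
    by (cases L) (simp add: add_singleton_def blocks_def open_blocks_def)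
qed

subsection \<open>Extending an open block\<close>

lemma extend_block_in:
  assumes L: "L \<in> marked_partitions n" and X: "X \<in> blocks L"
  shows "extend_block (Suc n) op (L, X) \<in> marked_partitions (Suc n)"
proof -
  note D = marked_partitionsD[OF L]
  have U: "\<Union>(blocks L) = {1..n}" using D(1) by (simp add: partition_on_def)
  have "partition_on {1..Suc n} (insert (insert (Suc n) X) (blocks L - {X}))"
  proof (rule partition_onI)
    have "{1..Suc n} = insert (Suc n) (\<Union>(blocks L))" unfolding U by auto
    then show "\<Union>(insert (insert (Suc n) X) (blocks L - {X})) = {1..Suc n}"
      using X by auto
  next
    fix Y Z
    assume "Y \<in> insert (insert (Suc n) X) (blocks L - {X})"
      "Z \<in> insert (insert (Suc n) X) (blocks L - {X})" "Y \<noteq> Z"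
    then show "disjnt Y Z"
      using Suc_notin_blocks(1)[OF L] D(6) X unfolding disjnt_iff by blast
  qed (use D(5) in auto)
  then show ?thesis
    using D(2) by (auto simp: marked_partitions_def extend_block_def)
qed

text \<open>Arcs join consecutive elements of a block. The new largest element is consecutive only
  to the old maximum of \<open>X\<close> and separates no two old elements, so one arc is gained and
  none is lost.\<close>

lemma arcs_extend_block:
  assumes L: "L \<in> marked_partitions n" and X: "X \<in> blocks L"
  shows "arcs (extend_block (Suc n) op (L, X)) = insert (Max X, Suc n) (arcs L)"
proof -
  note D = marked_partitionsD[OF L]
  let ?arc = "\<lambda>Y a b. a < b \<and> a \<in> Y \<and> b \<in> Y \<and> \<not> (\<exists>c \<in> Y. a < c \<and> c < b)"
  have mem: "(a, b) \<in> arcs (extend_block (Suc n) op (L, X)) \<longleftrightarrow>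
      ?arc (insert (Suc n) X) a b \<or> (\<exists>Y \<in> blocks L - {X}. ?arc Y a b)" for a b
    by (auto simp: arcs_def extend_block_def blocks_def)
  have mem': "(a, b) \<in> arcs L \<longleftrightarrow> ?arc X a b \<or> (\<exists>Y \<in> blocks L - {X}. ?arc Y a b)" for a b
    using X by (auto simp: arcs_def)
  have XD: "finite X" "X \<noteq> {}" "Max X \<in> X" "\<And>x. x \<in> X \<Longrightarrow> x \<le> n"
    using D(5)[OF X] by auto
  have arc_X: "?arc (insert (Suc n) X) a b \<longleftrightarrow> ?arc X a b \<or> (a = Max X \<and> b = Suc n)" for a b
  proof (cases "b = Suc n")
    case True
    \<comment> \<open>As \<open>Suc n\<close> exceeds every element of \<open>X\<close>, having
      nothing between \<open>a\<close> and \<open>Suc n\<close> means that \<open>a\<close> is an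
      upper bound of \<open>X\<close>.\<close>
    have "?arc (insert (Suc n) X) a b \<longleftrightarrow> a \<in> X \<and> (\<forall>c \<in> X. c \<le> a)"
      using True XD(4) by (fastforce simp: not_less le_imp_less_Suc)
    also have "\<dots> \<longleftrightarrow> a = Max X"
      using XD(1-3) by (metis Max_ge Max_eqI)
    finally show ?thesis using True XD(4) by auto
  next
    case False
    then show ?thesis using XD(4) by fastforce
  qed
  have "(a, b) \<in> arcs (extend_block (Suc n) op (L, X)) \<longleftrightarrow>
      (a, b) \<in> insert (Max X, Suc n) (arcs L)" for a b
    unfolding mem arc_X by (simp only: insert_iff mem' prod.inject disj_ac)
  then show ?thesis by (simp add: set_eq_iff split_paired_all)
qed

text \<open>The loss of one open block is stated as a sum to avoid truncated subtraction of
  naturals.\<close>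

lemma num_open_extend_block:
  assumes L: "L \<in> marked_partitions n" and X: "X \<in> open_blocks L"
  shows "num_open (extend_block (Suc n) op (L, X)) + (if op then 0 else 1) = num_open L"
proof -
  note D = marked_partitionsD[OF L]
  have "insert (Suc n) X \<notin> open_blocks L" by (rule Suc_notin_blocks(3)[OF L])
  moreover have "0 < card (open_blocks L)" using X D(4) by (auto simp: card_gt_0_iff)
  ultimately show ?thesis using D(4) X
    by (simp add: num_open_def extend_block_def open_blocks_def)
qed

text \<open>The arcs in \<open>over\<close> move from the open crossings to the arc crossings and
  cancel in the total. The mark \<open>op\<close> has no effect, since the enlarged block has
  maximum \<open>Suc n\<close> and no arc reaches beyond that.\<close>

lemma intertwining_weight_extend_block:
  assumes L: "L \<in> marked_partitions n" and X: "X \<in> open_blocks L"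
  shows "intertwining_weight (extend_block (Suc n) op (L, X)) =
    intertwining_weight L + card (open_above L X)"
proof -
  note D = marked_partitionsD[OF L]
  have XP: "X \<in> blocks L" using X D(2) by blast
  note arcs = arcs_extend_block[OF L XP]
  note bounds = arcs_bounds[OF L]
  let ?m = "Max X"
  let ?L = "extend_block (Suc n) op (L, X)"
  have m: "?m \<le> n" using D(5)[OF XP] by blast
  define over where "over = {(a, b) \<in> arcs L. a < ?m \<and> ?m < b}"
  have fin_over: "finite over"
    unfolding over_def by (rule finite_subset[OF _ finite_arcs[OF L]]) auto
  \<comment> \<open>The new arc ends last, so it can only be the second arc of a crossing, and its
    partners are exactly the old arcs over \<open>Max X\<close>.\<close>
  have "arc_crossings ?L = arc_crossings L \<union> (\<lambda>p. (p, (?m, Suc n))) ` over"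
    unfolding arc_crossings_def arcs over_def using bounds m by fastforce
  moreover have "arc_crossings L \<inter> (\<lambda>p. (p, (?m, Suc n))) ` over = {}"
    using bounds by (fastforce simp: arc_crossings_def)
  ultimately have 1: "card (arc_crossings ?L) = card (arc_crossings L) + card over"
    using fin_over finite_arc_crossings[OF L]
    by (simp add: card_Un_disjoint card_image inj_on_def)
  \<comment> \<open>\<open>rest\<close> holds the open crossings that survive; those with
    \<open>X\<close> disappear, as \<open>X\<close> is no longer a block.\<close>
  define rest where "rest = {((a, b), Y) \<in> open_crossings L. Y \<noteq> X}"
  have fin_rest: "finite rest"
    unfolding rest_def by (rule finite_subset[OF _ finite_open_crossings[OF L]]) auto
  have "open_crossings L = rest \<union> (\<lambda>p. (p, X)) ` over"
    using X by (auto simp: rest_def over_def open_crossings_def)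
  moreover have "rest \<inter> (\<lambda>p. (p, X)) ` over = {}" by (auto simp: rest_def)
  ultimately have 2: "card (open_crossings L) = card rest + card over"
    using fin_over fin_rest by (simp add: card_Un_disjoint card_image inj_on_def)
  have Max': "Max (insert (Suc n) X) = Suc n"
    using D(5)[OF XP] by (auto intro!: Max_eqI)
  have "open_crossings ?L = rest \<union> (\<lambda>Y. ((?m, Suc n), Y)) ` open_above L X"
  proof -
    have "(p, Y) \<in> open_crossings ?L \<longleftrightarrow>
        (p, Y) \<in> rest \<union> (\<lambda>Y. ((?m, Suc n), Y)) ` open_above L X" for p Y
    proof -
      obtain a b where p: "p = (a, b)" by (cases p)
      have "(p, Y) \<in> open_crossings ?L \<longleftrightarrow> (a, b) \<in> arcs ?L \<and> Y \<in> open_blocks L \<and> Y \<noteq> X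
          \<and> a < Max Y \<and> Max Y < b"
        using Max' Suc_notin_blocks(3)[OF L] unfolding p open_crossings_def arcs
        by (auto simp: extend_block_def open_blocks_def dest: bounds(3) split: if_splits)
      \<comment> \<open>An old arc gives an element of \<open>rest\<close>. For the new arc, the
        condition \<open>Max X < Max Y\<close> already forces \<open>Y\<close> to differ from
        \<open>X\<close>.\<close>
      also have "\<dots> \<longleftrightarrow> (p, Y) \<in> rest \<union> (\<lambda>Y. ((?m, Suc n), Y)) ` open_above L X"
        using D(2) D(5)[of Y] unfolding arcs p
        by (auto simp: rest_def open_crossings_def open_above_def less_Suc_eq_le)
      finally show ?thesis .
    qed
    then show ?thesis by auto
  qed
  moreover have "rest \<inter> (\<lambda>Y. ((?m, Suc n), Y)) ` open_above L X = {}"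
    using bounds by (fastforce simp: rest_def open_crossings_def)
  moreover have "finite (open_above L X)" using D(4) by (simp add: open_above_def)
  ultimately have 3: "card (open_crossings ?L) = card rest + card (open_above L X)"
    using fin_rest by (simp add: card_Un_disjoint card_image inj_on_def)
  show ?thesis using 1 2 3 by (simp add: intertwining_weight_def)
qed

lemma block_of_extend_block:
  assumes "L \<in> marked_partitions n" "X \<in> blocks L"
  shows "block_of (Suc n) (extend_block (Suc n) op (L, X)) = insert (Suc n) X"
  using Suc_notin_blocks(1)[OF assms(1)]
  by (auto simp: block_of_def extend_block_def blocks_def)

text \<open>Since \<open>X\<close> is nonempty, the enlarged block has an element besides
  \<open>Suc n\<close>; this separates extensions from added singletons.\<close>

lemma block_of_extend_block_neq:
  assumes "L \<in> marked_partitions n" "X \<in> blocks L"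
  shows "block_of (Suc n) (extend_block (Suc n) op (L, X)) \<noteq> {Suc n}"
  unfolding block_of_extend_block[OF assms]
  using marked_partitionsD(5)[OF assms] by auto

lemma block_of_extend_block_open:
  assumes "L \<in> marked_partitions n" "X \<in> blocks L"
  shows "block_of (Suc n) (extend_block (Suc n) op (L, X)) \<in>
    open_blocks (extend_block (Suc n) op (L, X)) \<longleftrightarrow> op"
  unfolding block_of_extend_block[OF assms]
  using Suc_notin_blocks(3)[OF assms(1)]
  by (simp add: extend_block_def open_blocks_def)

text \<open>The left inverse takes the block \<open>T\<close> of \<open>Suc n\<close>, deletes
  \<open>Suc n\<close> from it and puts the remainder back as an open block. The remainder must have
  been open, so one inverse serves both values of \<open>op\<close>.\<close>

lemma inj_on_extend_block:
  "inj_on (extend_block (Suc n) op) (SIGMA L : marked_partitions n. open_blocks L)"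
proof (rule inj_on_inverseI[where g = "\<lambda>L. let T = block_of (Suc n) L; X = T - {Suc n}
      in ((insert X (blocks L - {T}), insert X (open_blocks L - {T})), X)"])
  fix p assume "p \<in> (SIGMA L : marked_partitions n. open_blocks L)"
  then obtain L X where p: "p = (L, X)" and L: "L \<in> marked_partitions n"
    and X: "X \<in> open_blocks L" by auto
  note D = marked_partitionsD[OF L]
  have XP: "X \<in> blocks L" using X D(2) by blast
  have "Suc n \<notin> X" using D(5)[OF XP] by auto
  moreover have "insert (Suc n) X \<notin> blocks L" "insert (Suc n) X \<notin> open_blocks L"
    by (rule Suc_notin_blocks(2,3)[OF L])+
  moreover obtain P Q where "L = (P, Q)" by (cases L)
  ultimately show "(let T = block_of (Suc n) (extend_block (Suc n) op p); X = T - {Suc n}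
      in ((insert X (blocks (extend_block (Suc n) op p) - {T}),
        insert X (open_blocks (extend_block (Suc n) op p) - {T})), X)) = p"
    using X XP unfolding p block_of_extend_block[OF L XP] Let_def
    by (auto simp: extend_block_def blocks_def open_blocks_def)
qed

subsection \<open>Deleting the largest element\<close>

text \<open>This is the surjectivity of the two insertions. Whether the block \<open>T\<close> of
  \<open>Suc n\<close> is a singleton decides the case, and \<open>T \<in> Q\<close> gives the
  flag.\<close>

lemma marked_partitions_Suc_cases:
  assumes L: "L \<in> marked_partitions (Suc n)"
  obtains (singleton) op K where "K \<in> marked_partitions n" "L = add_singleton (Suc n) op K"
  | (extend) op K X where "K \<in> marked_partitions n" "X \<in> open_blocks K"
      "L = extend_block (Suc n) op (K, X)"
proof -
  note D = marked_partitionsD[OF L]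
  obtain P Q where PQ: "L = (P, Q)" by (cases L)
  have part: "partition_on {1..Suc n} P" and QP: "Q \<subseteq> P"
    using D(1,2) by (simp_all add: PQ blocks_def open_blocks_def)
  have UP: "\<Union>P = {1..Suc n}" using part by (simp add: partition_on_def)
  then have "Suc n \<in> \<Union>P" by simp
  then obtain T where T: "T \<in> P" "Suc n \<in> T" by blast
  have uniq: "Y = T" if "Y \<in> P" "x \<in> Y" "x \<in> T" for Y x
    using D(6) that T by (auto simp: PQ blocks_def)
  have ne: "{} \<notin> P" using part by (simp add: partition_on_def)
  have disj: "disjnt Y Z" if "Y \<in> P" "Z \<in> P" "Y \<noteq> Z" for Y Z
    using part that by (auto simp: partition_on_def disjoint_def disjnt_def)
  have U: "(\<Union>P) - {Suc n} = {1..n}" unfolding UP by auto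
  show ?thesis
  proof (cases "T = {Suc n}")
    case True
    have "partition_on {1..n} (P - {T})"
    proof (rule partition_onI)
      show "\<Union>(P - {T}) = {1..n}" using U True uniq[of _ "Suc n"] T by blast
    qed (use disj ne in auto)
    then have "(P - {T}, Q - {T}) \<in> marked_partitions n"
      using QP by (auto simp: marked_partitions_def)
    moreover have "L = add_singleton (Suc n) (T \<in> Q) (P - {T}, Q - {T})"
      using T True by (auto simp: PQ add_singleton_def blocks_def open_blocks_def)
    ultimately show ?thesis by (rule singleton)
  next
    case False
    define X where "X = T - {Suc n}"
    have T_eq: "T = insert (Suc n) X" using T by (auto simp: X_def)
    have X_ne: "X \<noteq> {}" using T False by (auto simp: X_def)
    then obtain x where x: "x \<in> X" by blast
    \<comment> \<open>If \<open>X\<close> were already a block, extending it again would remove that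
      block and fail to restore \<open>P\<close>. It is none, because it meets \<open>T\<close>
      without being equal to \<open>T\<close>.\<close>
    have X_notin: "X \<notin> P"
      using uniq[of X x] x T by (auto simp: X_def)
    have "partition_on {1..n} (insert X (P - {T}))"
    proof (rule partition_onI)
      show "\<Union>(insert X (P - {T})) = {1..n}"
        using U uniq[of _ "Suc n"] T unfolding X_def by blast
    next
      fix Y Z assume "Y \<in> insert X (P - {T})" "Z \<in> insert X (P - {T})" "Y \<noteq> Z"
      then show "disjnt Y Z"
        using disj T unfolding X_def disjnt_iff by blast
    qed (use ne X_ne in auto)
    then have "(insert X (P - {T}), insert X (Q - {T})) \<in> marked_partitions n"
      using QP by (auto simp: marked_partitions_def)
    moreover have "X \<in> open_blocks (insert X (P - {T}), insert X (Q - {T}))"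
      by (simp add: open_blocks_def)
    moreover have "L = extend_block (Suc n) (T \<in> Q)
        ((insert X (P - {T}), insert X (Q - {T})), X)"
      using T X_notin QP unfolding PQ extend_block_def
      by (auto simp: blocks_def open_blocks_def simp flip: T_eq)
    ultimately show ?thesis by (rule extend)
  qed
qed

subsection \<open>Counting\<close>

text \<open>The number of larger elements strictly decreases along the order, so it is injective; an
  injection into a finite set of the same size is onto.\<close>

lemma bij_betw_card_greater:
  fixes S :: "'a::linorder set"
  assumes "finite S"
  shows "bij_betw (\<lambda>x. card {y \<in> S. x < y}) S {..<card S}"
proof -
  let ?r = "\<lambda>x. card {y \<in> S. x < y}"
  have less: "?r y < ?r x" if "x \<in> S" "y \<in> S" "x < y" for x y
    using assms that by (intro psubset_card_mono) auto
  have inj: "inj_on ?r S"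
  proof (rule inj_onI)
    fix x y assume "x \<in> S" "y \<in> S" "?r x = ?r y"
    then show "x = y" using less[of x y] less[of y x] by (cases x y rule: linorder_cases) auto
  qed
  have "?r x < card S" if "x \<in> S" for x
    using assms that by (intro psubset_card_mono) auto
  then have "?r ` S \<subseteq> {..<card S}" by auto
  moreover have "card (?r ` S) = card {..<card S}" using inj by (simp add: card_image)
  ultimately have "?r ` S = {..<card S}" by (intro card_subset_eq) auto
  with inj show ?thesis by (simp add: bij_betw_def)
qed

text \<open>Disjoint nonempty blocks have distinct maxima, so ranking the open blocks reduces to
  ranking these numbers.\<close>

lemma bij_betw_card_open_above:
  assumes L: "L \<in> marked_partitions n"
  shows "bij_betw (\<lambda>X. card (open_above L X)) (open_blocks L) {..<num_open L}"
proof -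
  note D = marked_partitionsD[OF L]
  have inj: "inj_on Max (open_blocks L)"
  proof (rule inj_onI)
    fix X Y assume "X \<in> open_blocks L" "Y \<in> open_blocks L" "Max X = Max Y"
    then show "X = Y" using D(2) D(5)[of X] D(5)[of Y] D(6)[of X Y "Max X"] by auto
  qed
  let ?S = "Max ` open_blocks L"
  have "bij_betw (\<lambda>x. card {y \<in> ?S. x < y}) ?S {..<num_open L}"
    using bij_betw_card_greater[of ?S] D(4) by (simp add: num_open_def card_image[OF inj])
  then have "bij_betw ((\<lambda>x. card {y \<in> ?S. x < y}) \<circ> Max) (open_blocks L) {..<num_open L}"
    by (rule bij_betw_trans[OF inj_on_imp_bij_betw[OF inj]])
  moreover have "card {y \<in> ?S. Max X < y} = card (open_above L X)" for X
  proof -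
    have "{y \<in> ?S. Max X < y} = Max ` open_above L X" by (auto simp: open_above_def)
    then show ?thesis
      using inj by (auto simp: open_above_def intro!: card_image elim: inj_on_subset)
  qed
  ultimately show ?thesis by (simp add: comp_def)
qed

text \<open>Replace the chosen block \<open>X\<close> by its rank \<open>j\<close>, the number of
  open blocks above it. Each \<open>j\<close> from \<open>0\<close> to \<open>A - 1\<close>
  determines exactly one \<open>X\<close>, and the weight of \<open>L\<close> itself is then
  \<open>B - j\<close>. For \<open>A \<le> 0\<close> both sides vanish.\<close>

lemma card_open_pointed:
  "card (open_pointed n A B) = (\<Sum>j = 0..A - 1. f_i n A (B - j))"
proof -
  let ?M = "\<lambda>j. {L \<in> marked_partitions n.
     int (num_open L) = A \<and> int (intertwining_weight L) = B - j}"
  let ?h = "\<lambda>(L, X). (int (card (open_above L X)), L)"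
  have "bij_betw ?h (open_pointed n A B) (SIGMA j : {0..A - 1}. ?M j)"
    unfolding bij_betw_def
  proof
    show "inj_on ?h (open_pointed n A B)"
    proof (rule inj_onI)
      fix p q assume pq: "p \<in> open_pointed n A B" "q \<in> open_pointed n A B" "?h p = ?h q"
      obtain L X Y where LXY: "p = (L, X)" "q = (L, Y)"
        "card (open_above L X) = card (open_above L Y)"
        using pq(3) by (cases p, cases q) auto
      moreover have "L \<in> marked_partitions n" "X \<in> open_blocks L" "Y \<in> open_blocks L"
        using pq(1,2) LXY by (auto simp: open_pointed_def)
      ultimately have "X = Y"
        using inj_onD[OF bij_betw_imp_inj_on[OF bij_betw_card_open_above]] by blast
      then show "p = q" using LXY by simp
    qed
    show "?h ` open_pointed n A B = (SIGMA j : {0..A - 1}. ?M j)" (is "?l = ?r")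
    proof
      show "?l \<subseteq> ?r"
        using bij_betw_apply[OF bij_betw_card_open_above]
        by (fastforce simp: open_pointed_def)
      show "?r \<subseteq> ?l"
      proof
        fix q assume "q \<in> ?r"
        moreover obtain j L where q: "q = (j, L)" by (cases q)
        ultimately have j: "0 \<le> j" "j \<le> A - 1"
          and L: "L \<in> marked_partitions n" "int (num_open L) = A"
            "int (intertwining_weight L) = B - j" by simp_all
        \<comment> \<open>The rank \<open>j\<close> is an admissible one for the \<open>A\<close>
          open blocks of \<open>L\<close>, so some open block has it.\<close>
        have "nat j \<in> {..<num_open L}" using j L(2) by auto
        then have "nat j \<in> (\<lambda>X. card (open_above L X)) ` open_blocks L"
          using bij_betw_imp_surj_on[OF bij_betw_card_open_above[OF L(1)]] by simp
        then obtain X where "X \<in> open_blocks L" "card (open_above L X) = nat j"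
          by (metis imageE)
        then have "(L, X) \<in> open_pointed n A B" "?h (L, X) = q"
          using L j by (auto simp: open_pointed_def q)
        then show "q \<in> ?l" using imageI[of "(L, X)" "open_pointed n A B" ?h] by simp
      qed
    qed
  qed
  then have "card (open_pointed n A B) = card (SIGMA j : {0..A - 1}. ?M j)"
    by (rule bij_betw_same_card)
  also have "\<dots> = (\<Sum>j = 0..A - 1. f_i n A (B - j))"
    using finite_marked_partitions by (simp add: f_i_def)
  finally show ?thesis .
qed

section \<open>Assembling the recurrence from four disjoint classes\<close>

theorem theorem4p3:
  fixes n :: nat and A B :: int
  shows "f_i (n + 1) A B =
    f_i n A B + f_i n (A - 1) B
      + (\<Sum>j = 0..A. f_i n (A + 1) (B - j))
      + (\<Sum>j = 0..A - 1. f_i n A (B - j))"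
proof -
  let ?M = "\<lambda>n A. {L \<in> marked_partitions n.
     int (num_open L) = A \<and> int (intertwining_weight L) = B}"
  \<comment> \<open>In \<open>?S\<close> and \<open>?E\<close> the bound \<open>A\<close> counts the
    open blocks before the insertion.\<close>
  let ?S = "\<lambda>op A. add_singleton (Suc n) op ` ?M n A"
  let ?E = "\<lambda>op A. extend_block (Suc n) op ` open_pointed n A B"
  have pointedD: "L \<in> marked_partitions n" "X \<in> open_blocks L" "X \<in> blocks L"
    if "(L, X) \<in> open_pointed n A' B" for L X A'
    using that marked_partitionsD(2)[of L n] by (auto simp: open_pointed_def)
  have fin: "finite (?M n A')" "finite (open_pointed n A' B)" for A'
  proof -
    show "finite (?M n A')" using finite_marked_partitions by simp
    have "open_pointed n A' B \<subseteq> (SIGMA L : marked_partitions n. open_blocks L)"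
      by (auto simp: open_pointed_def)
    then show "finite (open_pointed n A' B)"
      by (rule finite_subset)
        (auto intro: finite_SigmaI finite_marked_partitions marked_partitionsD(4))
  qed
  have SE_neq: "add_singleton (Suc n) op K \<noteq> extend_block (Suc n) op' p"
    if "K \<in> marked_partitions n" "p \<in> open_pointed n A' B" for op op' K p A'
  proof -
    obtain K' X where p: "p = (K', X)" by (cases p)
    note K' = pointedD[OF that(2)[unfolded p]]
    show ?thesis
      using block_of_add_singleton[OF that(1), of op]
        block_of_extend_block_neq[OF K'(1,3), of op'] unfolding p by metis
  qed
  \<comment> \<open>An open singleton adds an open block, hence \<open>A - 1\<close>; closing the
    extended block removes one, hence \<open>A + 1\<close>; the other two insertions keep the
    number.\<close>
  have "?M (Suc n) A = ((?S False A \<union> ?S True (A - 1)) \<union> ?E False (A + 1)) \<union> ?E True A"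
  proof (intro equalityI subsetI)
    fix L assume "L \<in> ?M (Suc n) A"
    then have L: "L \<in> marked_partitions (Suc n)" and stat: "int (num_open L) = A"
      "int (intertwining_weight L) = B" by auto
    from L show "L \<in> ((?S False A \<union> ?S True (A - 1)) \<union> ?E False (A + 1)) \<union> ?E True A"
    proof (cases rule: marked_partitions_Suc_cases)
      case (singleton op K)
      then show ?thesis
        using stat num_open_add_singleton[of K n op]
          intertwining_weight_add_singleton[of K n op]
        by (cases op) auto
    next
      case (extend op K X)
      then have "(K, X) \<in> open_pointed n (if op then A else A + 1) B"
        using stat num_open_extend_block[of K n X op]
          intertwining_weight_extend_block[of K n X op]
        by (cases op) (auto simp: open_pointed_def)
      then show ?thesis using extend(3) by (cases op) auto
    qed
  next
    have S: "add_singleton (Suc n) op K \<in> ?M (Suc n) A"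
      if "K \<in> ?M n (if op then A - 1 else A)" for op K
      using that add_singleton_in[of K n op] num_open_add_singleton[of K n op]
        intertwining_weight_add_singleton[of K n op]
      by (cases op) auto
    have E: "extend_block (Suc n) op p \<in> ?M (Suc n) A"
      if "p \<in> open_pointed n (if op then A else A + 1) B" for op p
    proof -
      obtain K X where p: "p = (K, X)" by (cases p)
      note K = pointedD[OF that[unfolded p]]
      show ?thesis
        using that extend_block_in[OF K(1,3), of op] num_open_extend_block[OF K(1,2), of op]
          intertwining_weight_extend_block[OF K(1,2), of op]
        by (cases op) (auto simp: open_pointed_def p)
    qed
    fix L assume "L \<in> ((?S False A \<union> ?S True (A - 1)) \<union> ?E False (A + 1)) \<union> ?E True A"
    then show "L \<in> ?M (Suc n) A"
      using S[of _ False] S[of _ True] E[of _ False] E[of _ True]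
      unfolding if_True if_False by blast
  qed
  \<comment> \<open>The mark of the block containing \<open>Suc n\<close> tells the two values of
    \<open>op\<close> apart, here and for the two classes of extensions.\<close>
  moreover have "?S False A \<inter> ?S True (A - 1) = {}"
  proof -
    have "add_singleton (Suc n) False K \<noteq> add_singleton (Suc n) True K'"
      if "K \<in> marked_partitions n" "K' \<in> marked_partitions n" for K K'
      using block_of_add_singleton_open[OF that(1), of False]
        block_of_add_singleton_open[OF that(2), of True] by auto
    then show ?thesis by blast
  qed
  moreover have "(?S False A \<union> ?S True (A - 1)) \<inter> ?E False (A + 1) = {}"
    using SE_neq by blast
  moreover have "((?S False A \<union> ?S True (A - 1)) \<union> ?E False (A + 1)) \<inter> ?E True A = {}"
  proof -
    have "extend_block (Suc n) False p \<noteq> extend_block (Suc n) True q"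
      if pq: "p \<in> open_pointed n A' B" "q \<in> open_pointed n A'' B" for p q A' A''
    proof -
      obtain K X K' X' where "p = (K, X)" "q = (K', X')" by (cases p, cases q)
      then show ?thesis
        using block_of_extend_block_open[of K n X False] pointedD[of K X A'] pq
          block_of_extend_block_open[of K' n X' True] pointedD[of K' X' A''] by auto
    qed
    then show ?thesis using SE_neq by blast
  qed
  moreover have "card (?S op A') = f_i n A' B" for op A'
    unfolding f_i_def
    by (rule card_image, rule inj_on_subset[OF inj_on_add_singleton]) auto
  moreover have "card (?E op A') = (\<Sum>j = 0..A' - 1. f_i n A' (B - j))" for op A'
    unfolding card_open_pointed[symmetric]
    by (rule card_image, rule inj_on_subset[OF inj_on_extend_block])
      (auto simp: open_pointed_def)
  \<comment> \<open>The limit \<open>A + 1 - 1\<close> is left unsimplified to match the general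
    \<open>A' - 1\<close> at \<open>A' = A + 1\<close>.\<close>
  ultimately have "card (?M (Suc n) A) = f_i n A B + f_i n (A - 1) B
      + (\<Sum>j = 0..A + 1 - 1. f_i n (A + 1) (B - j)) + (\<Sum>j = 0..A - 1. f_i n A (B - j))"
    using fin by (simp only: card_Un_disjoint finite_UnI finite_imageI)
  then show ?thesis by (simp add: f_i_def)
qed

end
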